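(* (1) Let $X$ be a nonempty bounded metric space of density $d(X)$. Then for any set $A$ of cardinality $\#A\ge d(X)$, $$2d_{GH}\Bigl(X,\ (l^{\infty})\prod_{\alpha\in A}X\Bigr)=\operatorname{diam}(X).$$ (2) Let $X$ be an unbounded metric space of density $d(X)$. Then for any set $A$ of cardinality $\#A\ge d(X)$, $$d_{GH}\Bigl(X,\ (l^{\infty})\prod_{\alpha\in A}X\Bigr)=\infty.$$
   Context: All metric spaces are nonempty. $\#A$ is the cardinality of $A$. The density $d(X)$ of a topological space $X$ is the smallest cardinality of a dense subset of $X$. $\operatorname{diam}(X)=\sup_{x,y\in X}d_X(x,y)$. A correspondence between $X$ and $Y$ is a subset $R\subset X\times Y$ whose projections to $X$ and to $Y$ are surjective; $\mathcal R(X,Y)$ is the set of all correspondences. Its distortion is $\operatorname{dis}R=\sup\{|d_X(x,x')-d_Y(y,y')| : (x,y),(x',y')\in R\}$. The Gromov--Hausdorff distance is $d_{GH}(X,Y)=\frac12\inf\{\operatorname{dis}R: R\in\mathcal R(X,Y)\}\in[0,\infty]$. For a family $\{(X_\alpha,d_\alpha)\}_{\alpha\in A}$ of metric spaces, the $l^\infty$-product $(l^\infty)\prod_{\alpha\in A}X_\alpha$ is the Cartesian product $\prod_{\alpha\in A}X_\alpha$ with distance $d(\{x_\alpha\},\{y_\alpha\})=\sup_{\alpha\in A}d_\alpha(x_\alpha,y_\alpha)$. When the factors are unbounded this distance is allowed to take the value $+\infty$, and $d_{GH}$ is defined by the same formula. *)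

theory Defs
  imports "HOL-Analysis.Analysis"
begin

unbundle cardinal_syntax

text \<open>
  Cardinals are represented, as in the cardinal theories of the library, by minimal well-orders.
  The density of a topological space is the cardinal of a dense subset whose cardinality is
  smallest among the dense subsets; the choice of the witness affects it only up to \<open>=o\<close>.
\<close>

definition dense_subset :: "'a topology \<Rightarrow> 'a set \<Rightarrow> bool" where
  "dense_subset T D \<longleftrightarrow> D \<subseteq> topspace T \<and> T closure_of D = topspace T"

definition smallest_dense_subset :: "'a topology \<Rightarrow> 'a set \<Rightarrow> bool" where
  "smallest_dense_subset T D \<longleftrightarrow>
     dense_subset T D \<and> (\<forall>D'. dense_subset T D' \<longrightarrow> |D| \<le>o |D'| )"

definition density_card :: "'a topology \<Rightarrow> 'a rel" where
  "density_card T = |SOME D. smallest_dense_subset T D|"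

lemma smallest_dense_subset_exists: "\<exists>D. smallest_dense_subset T D"
proof -
  let ?R = "card_of ` {D. dense_subset T D}"
  have "topspace T \<in> {D. dense_subset T D}"
    by (simp add: dense_subset_def)
  then have "?R \<noteq> {}"
    by blast
  moreover have "\<forall>r\<in>?R. Well_order r"
    by (auto simp: card_of_Well_order)
  ultimately obtain r where "r \<in> ?R" "\<forall>r'\<in>?R. r \<le>o r'"
    using exists_minim_Well_order[of ?R] by blast
  then show ?thesis
    unfolding smallest_dense_subset_def by blast
qed

lemma density_card_witness:
  obtains D where "smallest_dense_subset T D" "density_card T = |D|"
  using someI_ex[OF smallest_dense_subset_exists[of T]] by (auto simp: density_card_def)

text \<open>
  Metric spaces are carriers with a real-valued distance (locale \<^locale>\<open>Metric_space\<close>). The notions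
  below take distances in \<^typ>\<open>ereal\<close>, so that they also apply to \<open>l\<^sup>\<infinity>\<close>-products of unbounded spaces.
\<close>

definition diam :: "'a set \<Rightarrow> ('a \<Rightarrow> 'a \<Rightarrow> ereal) \<Rightarrow> ereal" where
  "diam M d = (SUP (x, y) \<in> M \<times> M. d x y)"

definition correspondences :: "'a set \<Rightarrow> 'b set \<Rightarrow> ('a \<times> 'b) set set" where
  "correspondences M N = {R. R \<subseteq> M \<times> N \<and> fst ` R = M \<and> snd ` R = N}"

text \<open>
  In \<^typ>\<open>ereal\<close> one has \<open>\<bar>a - \<infinity>\<bar> = \<infinity>\<close> for every real \<open>a\<close>. (Also \<open>\<bar>\<infinity> - \<infinity>\<bar> = \<infinity>\<close>, a case that does
  not arise when one of the two distances takes only finite values.)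
\<close>

definition distortion ::
  "('a \<Rightarrow> 'a \<Rightarrow> ereal) \<Rightarrow> ('b \<Rightarrow> 'b \<Rightarrow> ereal) \<Rightarrow> ('a \<times> 'b) set \<Rightarrow> ereal" where
  "distortion d e R = (SUP ((x, y), (x', y')) \<in> R \<times> R. \<bar>d x x' - e y y'\<bar>)"

definition GH_dist ::
  "'a set \<Rightarrow> ('a \<Rightarrow> 'a \<Rightarrow> ereal) \<Rightarrow> 'b set \<Rightarrow> ('b \<Rightarrow> 'b \<Rightarrow> ereal) \<Rightarrow> ereal" where
  "GH_dist M d N e = 1 / 2 * (INF R \<in> correspondences M N. distortion d e R)"

text \<open>
  The carrier of the product of a family \<open>X\<close> indexed by \<open>A\<close> is \<^term>\<open>PiE A X\<close>; this is its
  \<open>l\<^sup>\<infinity>\<close>-distance (for nonempty \<open>A\<close>; in \<^typ>\<open>ereal\<close> the empty supremum is \<open>-\<infinity>\<close>).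
\<close>

definition linf_dist ::
  "'i set \<Rightarrow> ('i \<Rightarrow> 'a \<Rightarrow> 'a \<Rightarrow> ereal) \<Rightarrow> ('i \<Rightarrow> 'a) \<Rightarrow> ('i \<Rightarrow> 'a) \<Rightarrow> ereal" where
  "linf_dist A d f g = (SUP \<alpha> \<in> A. d \<alpha> (f \<alpha>) (g \<alpha>))"

end

theory Submission
  imports Defs
begin

text \<open>
  Write \<open>P\<close> for the \<open>l\<^sup>\<infinity>\<close>-power of \<open>M\<close> with exponent \<open>A\<close>. Every correspondence \<open>R\<close> between \<open>M\<close> and
  \<open>P\<close> has distortion at least the diameter of \<open>M\<close>, by a cardinality argument. Fix points \<open>a\<close>, \<open>b\<close>
  of \<open>M\<close>. The functions on \<open>A\<close> with values in \<open>{a, b}\<close> correspond to the subsets of \<open>A\<close>, and any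
  two different subsets give points of \<open>P\<close> at distance exactly \<open>d a b\<close>
  (\<open>linf_dist_two_valued\<close>). If the distortion of \<open>R\<close> were smaller than \<open>d a b\<close>, then partners in
  \<open>M\<close> of these points would form a uniformly separated family indexed by \<open>Pow A\<close>. Such a family
  is no larger than the density of \<open>M\<close> (\<open>separated_family_le_density\<close>), hence no larger than \<open>A\<close>,
  contrary to Cantor's theorem.

  If \<open>M\<close> is unbounded, its diameter is infinite and so is the Gromov-Hausdorff distance. If \<open>M\<close> is
  bounded, the lower bound is attained by the full correspondence \<open>M \<times> P\<close>: all
  distances in \<open>M\<close> and in \<open>P\<close> lie between \<open>0\<close> and the diameter of \<open>M\<close>, so no two of them
  differ by more than it.
\<close>

text \<open>
  The balls whose radius is half the separation are disjoint, and each contains a point of any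
  dense set; choosing one for each index is injective.
\<close>

lemma (in Metric_space) separated_family_le_density:
  fixes x :: "'i \<Rightarrow> 'a"
  assumes x: "\<And>i. i \<in> I \<Longrightarrow> x i \<in> M"
    and "\<delta> > 0"
    and sep: "\<And>i j. i \<in> I \<Longrightarrow> j \<in> I \<Longrightarrow> i \<noteq> j \<Longrightarrow> \<delta> \<le> d (x i) (x j)"
  shows "|I| \<le>o density_card mtopology"
proof -
  obtain D where D: "smallest_dense_subset mtopology D"
    and density: "density_card mtopology = |D|"
    by (rule density_card_witness)
  have dense: "mtopology closure_of D = M"
    using D by (simp add: smallest_dense_subset_def dense_subset_def)
  have "\<exists>y\<in>D. y \<in> mball (x i) (\<delta> / 2)" if "i \<in> I" for i
  proof -
    have "x i \<in> mtopology closure_of D"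
      using x[OF that] dense by simp
    then have "\<forall>r>0. \<exists>y\<in>D. y \<in> mball (x i) r"
      by (simp add: metric_closure_of)
    then show ?thesis
      using \<open>\<delta> > 0\<close> half_gt_zero by blast
  qed
  then obtain y where y: "\<And>i. i \<in> I \<Longrightarrow> y i \<in> D \<and> y i \<in> mball (x i) (\<delta> / 2)"
    by metis
  have "inj_on y I"
  proof (rule inj_onI, rule ccontr)
    fix i j
    assume ij: "i \<in> I" "j \<in> I" "y i = y j" "i \<noteq> j"
    have "d (x i) (x j) \<le> d (x i) (y i) + d (x j) (y i)"
      using y[OF ij(1)] y[OF ij(2)] ij(3) triangle'[of "x i" "y i" "x j"] by auto
    also have "\<dots> < \<delta>"
      using y[OF ij(1)] y[OF ij(2)] ij(3) by auto
    finally show False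
      using sep[OF ij(1,2,4)] by simp
  qed
  moreover have "y ` I \<subseteq> D"
    using y by blast
  ultimately show ?thesis
    unfolding density by (auto simp: card_of_ordLeq[symmetric])
qed

lemma (in Metric_space) linf_dist_two_valued:
  assumes "a \<in> M" "b \<in> M" "S \<subseteq> A" "T \<subseteq> A" "S \<noteq> T"
  shows "linf_dist A (\<lambda>_ x y. ereal (d x y))
           (\<lambda>\<alpha>\<in>A. if \<alpha> \<in> S then a else b) (\<lambda>\<alpha>\<in>A. if \<alpha> \<in> T then a else b) = ereal (d a b)"
  (is "linf_dist A ?d ?f ?g = _")
proof (rule antisym)
  show "linf_dist A ?d ?f ?g \<le> ereal (d a b)"
    unfolding linf_dist_def using assms by (intro SUP_least) (auto simp: commute)
  obtain \<alpha> where \<alpha>: "\<alpha> \<in> A" "\<alpha> \<in> S \<longleftrightarrow> \<alpha> \<notin> T"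
    using assms by blast
  then have "d (?f \<alpha>) (?g \<alpha>) = d a b"
    by (auto simp: commute)
  then show "ereal (d a b) \<le> linf_dist A ?d ?f ?g"
    unfolding linf_dist_def using SUP_upper[OF \<alpha>(1), of "\<lambda>\<alpha>. ereal (d (?f \<alpha>) (?g \<alpha>))"] by metis
qed

lemma distortion_upper:
  assumes "(x, y) \<in> R" "(x', y') \<in> R"
  shows "\<bar>d x x' - e y y'\<bar> \<le> distortion d e R"
  unfolding distortion_def
  by (rule SUP_upper2[of "((x, y), (x', y'))"]) (use assms in auto)

lemma distortion_le:
  assumes "R \<subseteq> M \<times> N"
    and "\<And>x x'. x \<in> M \<Longrightarrow> x' \<in> M \<Longrightarrow> 0 \<le> d x x' \<and> d x x' \<le> c"
    and "\<And>y y'. y \<in> N \<Longrightarrow> y' \<in> N \<Longrightarrow> 0 \<le> e y y' \<and> e y y' \<le> c"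
  shows "distortion d e R \<le> c"
proof -
  have diff: "\<bar>u - v\<bar> \<le> c" if "0 \<le> u \<and> u \<le> c" "0 \<le> v \<and> v \<le> c" for u v :: ereal
    using that by (cases u; cases v; cases c) auto
  have "\<bar>d x x' - e y y'\<bar> \<le> c" if "(x, y) \<in> R" "(x', y') \<in> R" for x y x' y'
    by (rule diff; rule assms) (use that assms(1) in auto)
  then show ?thesis
    unfolding distortion_def by (intro SUP_least) auto
qed

lemma diam_upper:
  assumes "x \<in> M" "y \<in> M"
  shows "d x y \<le> diam M d"
  unfolding diam_def by (rule SUP_upper2[of "(x, y)"]) (use assms in auto)

text \<open>
  The cardinality argument: a distortion below \<open>d a b\<close> would turn the functions with values in
  \<open>{a, b}\<close> into too large a separated family.
\<close>

lemma (in Metric_space) diam_le_distortion_power: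
  fixes A :: "'i set"
  assumes density: "density_card mtopology \<le>o |A|"
    and R: "R \<in> correspondences M (PiE A (\<lambda>_. M))"
  shows "diam M (\<lambda>x y. ereal (d x y))
           \<le> distortion (\<lambda>x y. ereal (d x y)) (linf_dist A (\<lambda>_ x y. ereal (d x y))) R"
    (is "_ \<le> ?dis")
proof -
  have "ereal (d a b) \<le> ?dis" if ab: "a \<in> M" "b \<in> M" for a b
  proof (rule ccontr)
    assume "\<not> ereal (d a b) \<le> ?dis"
    then obtain r where r: "?dis < ereal r" "ereal r < ereal (d a b)"
      using ereal_dense2 by (metis not_le)
    define f where "f S = (\<lambda>\<alpha>\<in>A. if \<alpha> \<in> S then a else b)" for S
    have "f S \<in> PiE A (\<lambda>_. M)" for S
      using ab by (auto simp: f_def)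
    then have "f S \<in> snd ` R" for S
      using R by (simp add: correspondences_def)
    then have "\<exists>x. (x, f S) \<in> R" for S
      by (simp add: image_iff Bex_def)
    then obtain x where xf: "\<And>S. (x S, f S) \<in> R"
      by metis
    have x: "x S \<in> M" for S
      using xf[of S] R by (auto simp: correspondences_def)
    have "d a b - r \<le> d (x S) (x T)" if "S \<in> Pow A" "T \<in> Pow A" "S \<noteq> T" for S T
    proof -
      have "\<bar>ereal (d (x S) (x T)) - linf_dist A (\<lambda>_ x y. ereal (d x y)) (f S) (f T)\<bar> \<le> ?dis"
        using distortion_upper[OF xf xf] .
      then have "ereal \<bar>d (x S) (x T) - d a b\<bar> \<le> ?dis"
        using linf_dist_two_valued[OF ab, of S A T] that by (simp add: f_def)
      also have "\<dots> < ereal r"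
        by (rule r(1))
      finally show ?thesis
        by simp
    qed
    then have "|Pow A| \<le>o density_card mtopology"
      using x r(2) by (intro separated_family_le_density[where x = x and \<delta> = "d a b - r"]) auto
    then have "|Pow A| \<le>o |A|"
      using density ordLeq_transitive by blast
    then show False
      using card_of_Pow[of A] not_ordLess_ordLeq by blast
  qed
  then show ?thesis
    unfolding diam_def by (intro SUP_least) auto
qed

lemma (in Metric_space) diam_unbounded:
  assumes "\<not> mbounded M"
  shows "diam M (\<lambda>x y. ereal (d x y)) = \<infinity>"
proof (rule ereal_top)
  fix B
  have "\<exists>x\<in>M. \<exists>y\<in>M. B < d x y"
    using assms by (auto simp: mbounded_alt not_le)
  then obtain x y where "x \<in> M" "y \<in> M" "B < d x y"
    by blast
  then show "ereal B \<le> diam M (\<lambda>x y. ereal (d x y))"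
    using diam_upper[of x M y "\<lambda>x y. ereal (d x y)"]
    by (meson ereal_less_eq(3) less_imp_le order_trans)
qed

lemma (in Metric_space) linf_dist_power_bounds:
  assumes "A \<noteq> {}" "f \<in> PiE A (\<lambda>_. M)" "g \<in> PiE A (\<lambda>_. M)"
  shows "0 \<le> linf_dist A (\<lambda>_ x y. ereal (d x y)) f g \<and>
         linf_dist A (\<lambda>_ x y. ereal (d x y)) f g \<le> diam M (\<lambda>x y. ereal (d x y))"
proof
  obtain \<alpha> where "\<alpha> \<in> A"
    using assms by blast
  then show "0 \<le> linf_dist A (\<lambda>_ x y. ereal (d x y)) f g"
    unfolding linf_dist_def by (rule SUP_upper2) simp
  show "linf_dist A (\<lambda>_ x y. ereal (d x y)) f g \<le> diam M (\<lambda>x y. ereal (d x y))"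
    unfolding linf_dist_def
  proof (rule SUP_least)
    fix \<alpha>
    assume "\<alpha> \<in> A"
    then have "f \<alpha> \<in> M" "g \<alpha> \<in> M"
      using assms by auto
    then show "ereal (d (f \<alpha>) (g \<alpha>)) \<le> diam M (\<lambda>x y. ereal (d x y))"
      by (rule diam_upper)
  qed
qed

text \<open>
  In \<^typ>\<open>ereal\<close> this formula covers the bounded and the unbounded case at once.
\<close>

lemma (in Metric_space) INF_distortion_power:
  fixes A :: "'i set"
  assumes "M \<noteq> {}" and density: "density_card mtopology \<le>o |A|"
  shows "(INF R \<in> correspondences M (PiE A (\<lambda>_. M)).
            distortion (\<lambda>x y. ereal (d x y)) (linf_dist A (\<lambda>_ x y. ereal (d x y))) R)
         = diam M (\<lambda>x y. ereal (d x y))"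
proof (rule antisym)
  \<comment> \<open>The family consisting of one point of \<open>M\<close> shows that the density is not \<open>0\<close>; for empty \<open>A\<close>
      the distance \<^const>\<open>linf_dist\<close> would be \<open>-\<infinity>\<close>.\<close>
  have "A \<noteq> {}"
  proof
    assume "A = {}"
    obtain p where "p \<in> M"
      using \<open>M \<noteq> {}\<close> by blast
    then have "|{()}| \<le>o density_card mtopology"
      by (intro separated_family_le_density[where x = "\<lambda>_. p" and \<delta> = 1]) auto
    then have "|{()}| \<le>o |{} :: 'i set|"
      using density \<open>A = {}\<close> ordLeq_transitive by blast
    then show False
      by (simp add: card_of_ordLeq[symmetric])
  qed
  have "M \<times> PiE A (\<lambda>_. M) \<in> correspondences M (PiE A (\<lambda>_. M))"
    using \<open>M \<noteq> {}\<close> by (simp add: correspondences_def PiE_eq_empty_iff)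
  moreover have "distortion (\<lambda>x y. ereal (d x y)) (linf_dist A (\<lambda>_ x y. ereal (d x y)))
                   (M \<times> PiE A (\<lambda>_. M)) \<le> diam M (\<lambda>x y. ereal (d x y))"
    using linf_dist_power_bounds[OF \<open>A \<noteq> {}\<close>]
    by (intro distortion_le[OF order_refl]) (auto intro: diam_upper)
  ultimately show "(INF R \<in> correspondences M (PiE A (\<lambda>_. M)).
      distortion (\<lambda>x y. ereal (d x y)) (linf_dist A (\<lambda>_ x y. ereal (d x y))) R)
    \<le> diam M (\<lambda>x y. ereal (d x y))"
    by (rule INF_lower2)
  show "diam M (\<lambda>x y. ereal (d x y)) \<le> (INF R \<in> correspondences M (PiE A (\<lambda>_. M)).
      distortion (\<lambda>x y. ereal (d x y)) (linf_dist A (\<lambda>_ x y. ereal (d x y))) R)"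
    using diam_le_distortion_power[OF density] by (rule INF_greatest)
qed

theorem theorem4p4:
  fixes M :: "'a set" and d :: "'a \<Rightarrow> 'a \<Rightarrow> real" and A :: "'i set"
  assumes "Metric_space M d"
    and "M \<noteq> {}"
    and "density_card (Metric_space.mtopology M d) \<le>o |A|"
  shows "(Metric_space.mbounded M d M \<longrightarrow>
            2 * GH_dist M (\<lambda>x y. ereal (d x y))
                  (PiE A (\<lambda>_. M)) (linf_dist A (\<lambda>_ x y. ereal (d x y)))
            = diam M (\<lambda>x y. ereal (d x y))) \<and>
         (\<not> Metric_space.mbounded M d M \<longrightarrow>
            GH_dist M (\<lambda>x y. ereal (d x y))
              (PiE A (\<lambda>_. M)) (linf_dist A (\<lambda>_ x y. ereal (d x y)))
            = \<infinity>)"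
proof -
  have half: "2 * (1 / 2 * c) = c" "1 / 2 * \<infinity> = (\<infinity> :: ereal)" for c :: ereal
    by (cases c; simp add: one_ereal_def)+
  show ?thesis
    unfolding GH_dist_def Metric_space.INF_distortion_power[OF assms]
    using Metric_space.diam_unbounded[OF assms(1)] half by metis
qed

end
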